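(* Let $G$ be a finite simple connected graph with vertex set $V$, and let $\omega=\omega(G)$ be its clique number. For each vertex $v\in V$, let $c(v)$ denote the order of the largest clique of $G$ containing $v$. Let $q(G)$ be the largest eigenvalue of the signless Laplacian $Q(G)=D(G)+A(G)$. Then \[ q(G) \leq 2\sum_{v \in V}\left(1 - \frac{1}{c(v)}\right).\] Equality holds if and only if $G$ is a complete bipartite graph when $\omega=2$, or a regular complete $\omega$-partite graph when $\omega\ge 3$.
   Context: $A(G)$ is the adjacency matrix of $G$ and $D(G)$ is the diagonal matrix of vertex degrees; $q(G)=\lambda_1(D(G)+A(G))$ is called the $Q$-index of $G$. The clique number $\omega(G)$ is the order of a largest complete subgraph of $G$. *)

theory Defs
  imports
    "Jordan_Normal_Form.Spectral_Radius"
    "Graph_Theory.Graph_Theory"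
    "HOL-Library.Disjoint_Sets"
begin

text \<open>
  A finite simple graph is a \<^verbatim>\<open>graph\<close> of the entry Graph_Theory: a finite, loop-free,
  symmetric digraph without parallel arcs, so that an undirected edge is a pair of opposite arcs
  and the degree of a vertex is its out-degree. Graph_Theory's connected graphs are nonempty.

  The rows and columns of the matrices follow an enumeration \<open>vs\<close> of the vertices, i.e. a
  distinct list with \<open>set vs = verts G\<close>. Another enumeration conjugates the matrices by a
  permutation matrix and leaves the eigenvalues unchanged.
\<close>

definition adjacency_mat :: "('a, 'b) pre_digraph \<Rightarrow> 'a list \<Rightarrow> real mat" where
  "adjacency_mat G vs =
     mat (length vs) (length vs) (\<lambda>(i, j). if vs ! i \<rightarrow>\<^bsub>G\<^esub> vs ! j then 1 else 0)"

definition degree_mat :: "('a, 'b) pre_digraph \<Rightarrow> 'a list \<Rightarrow> real mat" where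
  "degree_mat G vs = mat_diag (length vs) (\<lambda>i. real (out_degree G (vs ! i)))"

definition signless_laplacian :: "('a, 'b) pre_digraph \<Rightarrow> 'a list \<Rightarrow> real mat" where
  "signless_laplacian G vs = degree_mat G vs + adjacency_mat G vs"

definition Q_index :: "('a, 'b) pre_digraph \<Rightarrow> 'a list \<Rightarrow> real" where
  "Q_index G vs = Max (spectrum (signless_laplacian G vs))"

definition clique_number :: "('a, 'b) pre_digraph \<Rightarrow> nat" where
  "clique_number G = Max {k. \<exists>H. subgraph H G \<and> complete_digraph k H}"

definition vertex_clique_number :: "('a, 'b) pre_digraph \<Rightarrow> 'a \<Rightarrow> nat" where
  "vertex_clique_number G v = Max {k. \<exists>H. subgraph H G \<and> complete_digraph k H \<and> v \<in> verts H}"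

definition regular_graph :: "('a, 'b) pre_digraph \<Rightarrow> bool" where
  "regular_graph G \<longleftrightarrow> graph G \<and> (\<exists>d. \<forall>v \<in> verts G. out_degree G v = d)"

text \<open>The \<open>r\<close> parts are nonempty, as \<open>partition_on\<close> excludes the empty block.\<close>

definition complete_multipartite_graph :: "nat \<Rightarrow> ('a, 'b) pre_digraph \<Rightarrow> bool" where
  "complete_multipartite_graph r G \<longleftrightarrow> graph G \<and>
     (\<exists>P. partition_on (verts G) P \<and> card P = r \<and>
        arcs_ends G = {(u, v). \<exists>A \<in> P. \<exists>B \<in> P. A \<noteq> B \<and> u \<in> A \<and> v \<in> B})"

end

theory Submission
  imports Defs
begin

text \<open>
  Put \<open>a v = 1 - 1 / c v\<close> for the clique order \<open>c v\<close> of the vertex \<open>v\<close>, and let \<open>F(y, x)\<close> be the sum of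
  \<open>y u * y v * (x u + x v)^2\<close> over ordered adjacent pairs. The inequality
  \<open>F(y, x) \<le> 4 * (\<Sum>v. a v * y v) * (\<Sum>v. y v * (x v)^2)\<close> holds for all weights \<open>y \<ge> 0\<close>: for
  nonadjacent \<open>u\<close>, \<open>v\<close> both sides are affine in \<open>y\<close> along the direction \<open>e_u / a u - e_v / a v\<close>, which
  fixes \<open>\<Sum>v. a v * y v\<close>, so the weights can be moved onto a clique as in the Motzkin-Straus argument,
  and there Cauchy-Schwarz suffices. The bound on the Q-index is the case where \<open>y = 1\<close> and \<open>x\<close> is an
  eigenvector.

  If equality holds, \<open>x\<close> may be replaced by its absolute value, which is then a positive eigenvector.
  Since \<open>y = 1\<close> is an interior minimum of the difference of the two sides, the second variation in the
  direction \<open>e_u / a u + e_w / a w - 2 * e_v / a v\<close> shows that nonadjacency is transitive, i.e. the graph is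
  complete multipartite. Then \<open>a\<close> is constant, and \<open>(x u + x v)^2 = (x u - x v)^2 + 4 * x u * x v\<close>
  together with the Motzkin-Straus bound for the weights \<open>x\<close> forces \<open>x\<close> to be constant if \<open>a > 1/2\<close>.
\<close>

section \<open>The weighted edge form\<close>

text \<open>For \<open>y = 1\<close> this is twice the quadratic form of the signless Laplacian,
  each edge being counted in both directions. For \<open>x = 1\<close> it is four times the
  adjacency form of \<open>y\<close>, as in Motzkin-Straus.\<close>

definition edge_form :: "'a set \<Rightarrow> ('a \<Rightarrow> 'a \<Rightarrow> bool) \<Rightarrow> ('a \<Rightarrow> real) \<Rightarrow> ('a \<Rightarrow> real) \<Rightarrow> real" where
  "edge_form V E y x = (\<Sum>u\<in>V. \<Sum>v\<in>V. of_bool (E u v) * (y u * y v * (x u + x v)\<^sup>2))"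

text \<open>Lagrange's identity with weights: the defect in Cauchy-Schwarz is a sum of squares. It
  yields the inequality, and later it measures how far an extremal function is from
  constant.\<close>

lemma sum_sum_weighted_square_diff:
  fixes x y :: "'a \<Rightarrow> real"
  shows "(\<Sum>u\<in>V. \<Sum>v\<in>V. y u * y v * (x u - x v)\<^sup>2) =
    2 * ((\<Sum>v\<in>V. y v) * (\<Sum>v\<in>V. y v * (x v)\<^sup>2) - (\<Sum>v\<in>V. y v * x v)\<^sup>2)"
proof -
  have "(\<Sum>u\<in>V. \<Sum>v\<in>V. y u * y v * (x u - x v)\<^sup>2) =
      (\<Sum>u\<in>V. \<Sum>v\<in>V. (y u * (x u)\<^sup>2) * y v + y u * (y v * (x v)\<^sup>2) - (2 * (y u * x u)) * (y v * x v))"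
    by (intro sum.cong refl) (simp add: power2_eq_square algebra_simps)
  also have "\<dots> = (\<Sum>u\<in>V. y u * (x u)\<^sup>2) * (\<Sum>v\<in>V. y v) + (\<Sum>u\<in>V. y u) * (\<Sum>v\<in>V. y v * (x v)\<^sup>2)
      - (\<Sum>u\<in>V. 2 * (y u * x u)) * (\<Sum>v\<in>V. y v * x v)"
    by (simp only: sum.distrib sum_subtractf sum_product)
  also have "\<dots> = 2 * ((\<Sum>v\<in>V. y v) * (\<Sum>v\<in>V. y v * (x v)\<^sup>2) - (\<Sum>v\<in>V. y v * x v)\<^sup>2)"
    unfolding sum_distrib_left[symmetric] by (simp add: power2_eq_square algebra_simps)
  finally show ?thesis .
qed

lemma weighted_Cauchy_Schwarz:
  fixes x y :: "'a \<Rightarrow> real"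
  assumes "\<And>v. v \<in> V \<Longrightarrow> 0 \<le> y v"
  shows "(\<Sum>v\<in>V. y v * x v)\<^sup>2 \<le> (\<Sum>v\<in>V. y v) * (\<Sum>v\<in>V. y v * (x v)\<^sup>2)"
proof -
  have "0 \<le> (\<Sum>u\<in>V. \<Sum>v\<in>V. y u * y v * (x u - x v)\<^sup>2)"
    by (intro sum_nonneg mult_nonneg_nonneg assms) auto
  then show ?thesis unfolding sum_sum_weighted_square_diff by simp
qed

text \<open>Every ordered pair off the diagonal is adjacent, so the full double sum, which factors
  into single sums, only has to be corrected by the diagonal terms
  \<open>4 * (y v * x v)^2\<close>.\<close>

lemma edge_form_clique:
  assumes "finite W" and "\<And>u v. u \<in> W \<Longrightarrow> v \<in> W \<Longrightarrow> E u v \<longleftrightarrow> u \<noteq> v"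
  shows "edge_form W E y x = 2 * (\<Sum>v\<in>W. y v) * (\<Sum>v\<in>W. y v * (x v)\<^sup>2)
    + 2 * (\<Sum>v\<in>W. y v * x v)\<^sup>2 - 4 * (\<Sum>v\<in>W. (y v * x v)\<^sup>2)"
proof -
  have diag: "(\<Sum>v\<in>W. if u = v then y u * y v * (x u + x v)\<^sup>2 else 0) = 4 * (y u * x u)\<^sup>2"
    if "u \<in> W" for u
    using assms(1) that by (simp add: power2_eq_square algebra_simps)
  have "edge_form W E y x = (\<Sum>u\<in>W. \<Sum>v\<in>W. (y u * (x u)\<^sup>2) * y v + y u * (y v * (x v)\<^sup>2)
      + (2 * (y u * x u)) * (y v * x v) - (if u = v then y u * y v * (x u + x v)\<^sup>2 else 0))"
    unfolding edge_form_def
    by (intro sum.cong refl) (auto simp: assms power2_eq_square algebra_simps)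
  also have "\<dots> = (\<Sum>u\<in>W. y u * (x u)\<^sup>2) * (\<Sum>v\<in>W. y v) + (\<Sum>u\<in>W. y u) * (\<Sum>v\<in>W. y v * (x v)\<^sup>2)
      + (\<Sum>u\<in>W. 2 * (y u * x u)) * (\<Sum>v\<in>W. y v * x v) - (\<Sum>u\<in>W. 4 * (y u * x u)\<^sup>2)"
    by (simp only: sum.distrib sum_subtractf sum_product diag cong: sum.cong)
  also have "\<dots> = 2 * (\<Sum>v\<in>W. y v) * (\<Sum>v\<in>W. y v * (x v)\<^sup>2)
      + 2 * (\<Sum>v\<in>W. y v * x v)\<^sup>2 - 4 * (\<Sum>v\<in>W. (y v * x v)\<^sup>2)"
    unfolding sum_distrib_left[symmetric] by (simp add: power2_eq_square algebra_simps)
  finally show ?thesis .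
qed

lemma edge_form_cong:
  assumes "\<And>v. v \<in> V \<Longrightarrow> y v = y' v" "\<And>v. v \<in> V \<Longrightarrow> x v = x' v"
  shows "edge_form V E y x = edge_form V E y' x'"
  unfolding edge_form_def by (intro sum.cong refl) (simp add: assms)

lemma edge_form_insert:
  assumes "finite W" "u \<notin> W" and sym: "\<And>u v. E u v \<Longrightarrow> E v u" and irrefl: "\<And>u. \<not> E u u"
  shows "edge_form (insert u W) E y x = edge_form W E y x
    + 2 * y u * (\<Sum>w\<in>W. of_bool (E u w) * (y w * (x u + x w)\<^sup>2))"
proof -
  have sym': "E w u \<longleftrightarrow> E u w" for w using sym by blast
  show ?thesis
    unfolding edge_form_def using assms(1,2)
    by (simp add: irrefl sym' sum.distrib sum_distrib_left algebra_simps)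
qed

text \<open>In the notation of the proof the form is \<open>2 * Y * S + 2 * X^2 - 4 * P\<close>. The
  fraction \<open>2 / k\<close> of \<open>X^2\<close> is absorbed by \<open>P\<close> through
  \<open>X^2 <= k * P\<close>, and the remaining fraction is bounded by
  \<open>X^2 <= Y * S\<close>.\<close>

lemma edge_form_clique_le:
  assumes fin: "finite W" and E: "\<And>u v. u \<in> W \<Longrightarrow> v \<in> W \<Longrightarrow> E u v \<longleftrightarrow> u \<noteq> v"
    and a: "\<And>v. v \<in> W \<Longrightarrow> 1 - 1 / real (card W) \<le> a v"
    and y: "\<And>v. v \<in> W \<Longrightarrow> 0 \<le> y v"
  shows "edge_form W E y x \<le> 4 * (\<Sum>v\<in>W. a v * y v) * (\<Sum>v\<in>W. y v * (x v)\<^sup>2)"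
proof -
  define Y S X P where "Y = (\<Sum>v\<in>W. y v)" and "S = (\<Sum>v\<in>W. y v * (x v)\<^sup>2)"
    and "X = (\<Sum>v\<in>W. y v * x v)" and "P = (\<Sum>v\<in>W. (y v * x v)\<^sup>2)"
  define k where "k = real (card W)"
  have "S \<ge> 0" "Y \<ge> 0" unfolding S_def Y_def by (auto intro!: sum_nonneg mult_nonneg_nonneg y)
  have "(1 - 1 / k) * Y \<le> (\<Sum>v\<in>W. a v * y v)"
    unfolding Y_def sum_distrib_left k_def by (intro sum_mono mult_right_mono a y)
  then have "4 * ((1 - 1 / k) * Y) * S \<le> 4 * (\<Sum>v\<in>W. a v * y v) * S"
    using \<open>S \<ge> 0\<close> by (simp add: mult_right_mono)
  moreover have "edge_form W E y x \<le> 4 * ((1 - 1 / k) * Y) * S"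
  proof -
    \<comment> \<open>The fraction \<open>1 - 2 / k\<close> has to be nonnegative, so sets with
      fewer than two vertices, whose form is zero, are treated apart.\<close>
    consider "card W = 0" | "card W = 1" | "k \<ge> 2" unfolding k_def by linarith
    then show ?thesis
    proof cases
      case 1
      then show ?thesis using fin by (simp add: edge_form_def S_def)
    next
      case 2
      then obtain w where "W = {w}" using card_1_singletonE by blast
      then show ?thesis using E 2 by (simp add: edge_form_def k_def)
    next
      case 3
      have 1: "X\<^sup>2 \<le> Y * S"
        unfolding X_def Y_def S_def by (rule weighted_Cauchy_Schwarz) (rule y)
      have 2: "X\<^sup>2 \<le> k * P"
        using weighted_Cauchy_Schwarz[of W "\<lambda>_. 1" "\<lambda>v. y v * x v"]
        by (simp add: X_def P_def k_def)
      have "(1 - 2 / k) * X\<^sup>2 \<le> (1 - 2 / k) * (Y * S)"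
        using 3 by (intro mult_left_mono 1) (auto simp: field_simps)
      moreover have "(2 / k) * X\<^sup>2 \<le> (2 / k) * (k * P)"
        using 3 by (intro mult_left_mono 2) auto
      then have "(2 / k) * X\<^sup>2 \<le> 2 * P" using 3 by simp
      moreover have "edge_form W E y x = 2 * Y * S + 2 * X\<^sup>2 - 4 * P"
        unfolding Y_def S_def X_def P_def by (rule edge_form_clique[OF fin E])
      moreover have "4 * ((1 - 1 / k) * Y) * S = 2 * ((1 - 2 / k) * (Y * S)) + 2 * Y * S"
        "(1 - 2 / k) * X\<^sup>2 = X\<^sup>2 - (2 / k) * X\<^sup>2"
        by (simp_all add: algebra_simps)
      ultimately show ?thesis by linarith
    qed
  qed
  ultimately show ?thesis by (simp add: S_def)
qed

text \<open>Induction on \<open>card W\<close>. If \<open>u\<close> and \<open>v\<close> are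
  nonadjacent, no term contains \<open>y u * y v\<close>, and \<open>y\<close> lies between two
  weights that vanish at \<open>v\<close> and at \<open>u\<close> respectively, to which the
  induction hypothesis applies. Without such a pair \<open>W\<close> is a clique.\<close>

theorem edge_form_le:
  fixes a x y :: "'a \<Rightarrow> real"
  assumes "finite W"
    and sym: "\<And>u v. E u v \<Longrightarrow> E v u" and irrefl: "\<And>u. \<not> E u u"
    and pos: "\<And>v. v \<in> W \<Longrightarrow> 0 < a v"
    and clique: "\<And>K v. K \<subseteq> W \<Longrightarrow> pairwise E K \<Longrightarrow> v \<in> K \<Longrightarrow>
      1 - 1 / real (card K) \<le> a v"
    and y: "\<And>v. v \<in> W \<Longrightarrow> 0 \<le> y v"
  shows "edge_form W E y x \<le> 4 * (\<Sum>v\<in>W. a v * y v) * (\<Sum>v\<in>W. y v * (x v)\<^sup>2)"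
  using assms(1) pos clique y
proof (induction "card W" arbitrary: W y rule: less_induct)
  case less
  show ?case
  proof (cases "\<forall>u\<in>W. \<forall>v\<in>W. u \<noteq> v \<longrightarrow> E u v")
    case True
    show ?thesis
    proof (rule edge_form_clique_le)
      show "1 - 1 / real (card W) \<le> a v" if "v \<in> W" for v
        by (rule less.prems(3)) (use True that in \<open>auto simp: pairwise_def\<close>)
    qed (use less.prems True irrefl in auto)
  next
    case False
    then obtain u v where uv: "u \<in> W" "v \<in> W" "u \<noteq> v" "\<not> E u v" by blast
    then have vu: "\<not> E v u" using sym by blast
    define W' where "W' = W - {u, v}"
    have W: "W = insert u (insert v W')" and notin: "u \<notin> W'" "v \<notin> W'"
      using uv unfolding W'_def by auto
    have fin: "finite W'" using less.prems(1) W'_def by simp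
    \<comment> \<open>\<open>\<tau>\<close> is the share of \<open>u\<close> and \<open>v\<close> in
      the sum of \<open>a w * y w\<close>. It is kept fixed, so putting all of it on one vertex
      \<open>z\<close> gives \<open>z\<close> the weight \<open>\<tau> / a z\<close>.\<close>
    define \<tau> where "\<tau> = a u * y u + a v * y v"
    define N where "N z = (\<Sum>w\<in>W'. of_bool (E z w) * (y w * (x z + x w)\<^sup>2))" for z
    define R where "R = edge_form W' E y x"
    define T where "T = (\<Sum>w\<in>W'. a w * y w)"
    define S where "S = (\<Sum>w\<in>W'. y w * (x w)\<^sup>2)"
    have au: "a u > 0" and av: "a v > 0" and yu: "y u \<ge> 0" and yv: "y v \<ge> 0"
      using less.prems uv by auto
    have \<tau>0: "\<tau> \<ge> 0" unfolding \<tau>_def using au av yu yv by simp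
    have IH: "R + 2 * (\<tau> / a z) * N z \<le> 4 * (T + \<tau>) * (S + \<tau> / a z * (x z)\<^sup>2)"
      if z: "z = u \<or> z = v" for z
    proof -
      have zW: "z \<notin> W'" "a z > 0" "insert z W' \<subset> W" using z notin au av W uv(3) by auto
      define y' where "y' = y(z := \<tau> / a z)"
      have "edge_form (insert z W') E y' x \<le>
          4 * (\<Sum>v\<in>insert z W'. a v * y' v) * (\<Sum>v\<in>insert z W'. y' v * (x v)\<^sup>2)"
      proof (rule less.hyps)
        show "card (insert z W') < card W" using zW(3) less.prems(1) psubset_card_mono by blast
        show "1 - 1 / real (card K) \<le> a v'"
          if "K \<subseteq> insert z W'" "pairwise E K" "v' \<in> K" for K v'
          by (rule less.prems(3)) (use that zW(3) in auto)
        show "0 < a w" if "w \<in> insert z W'" for w using that zW less.prems(2) W by auto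
        show "0 \<le> y' w" if "w \<in> insert z W'" for w
          using that zW less.prems(4) W \<tau>0 by (auto simp: y'_def)
      qed (use fin in simp)
      moreover have "edge_form (insert z W') E y' x = R + 2 * (\<tau> / a z) * N z"
      proof -
        have "edge_form W' E y' x = R"
          unfolding R_def by (rule edge_form_cong) (use zW in \<open>auto simp: y'_def\<close>)
        moreover have "(\<Sum>w\<in>W'. of_bool (E z w) * (y' w * (x z + x w)\<^sup>2)) = N z"
          unfolding N_def by (intro sum.cong refl) (use zW in \<open>auto simp: y'_def\<close>)
        moreover have "y' z = \<tau> / a z" by (simp add: y'_def)
        ultimately show ?thesis
          by (simp only: edge_form_insert[OF fin zW(1) sym irrefl])
      qed
      moreover have "(\<Sum>w\<in>W'. a w * y' w) = T" "(\<Sum>w\<in>W'. y' w * (x w)\<^sup>2) = S"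
        unfolding T_def S_def by (intro sum.cong refl; use zW in \<open>auto simp: y'_def\<close>)+
      ultimately show ?thesis
        using fin zW by (simp add: y'_def algebra_simps)
    qed
    have F: "edge_form W E y x = R + 2 * y v * N v + 2 * y u * N u"
    proof -
      have "edge_form W E y x = edge_form (insert v W') E y x
          + 2 * y u * (\<Sum>w\<in>insert v W'. of_bool (E u w) * (y w * (x u + x w)\<^sup>2))"
        unfolding W by (rule edge_form_insert) (use fin notin uv(3) sym irrefl in auto)
      also have "(\<Sum>w\<in>insert v W'. of_bool (E u w) * (y w * (x u + x w)\<^sup>2)) = N u"
        using fin notin uv(4) by (simp add: N_def)
      finally show ?thesis
        by (simp add: edge_form_insert[OF fin notin(2) sym irrefl] R_def N_def)
    qed
    have T': "(\<Sum>w\<in>W. a w * y w) = T + \<tau>" and S': "(\<Sum>w\<in>W. y w * (x w)\<^sup>2) = S + y u * (x u)\<^sup>2 + y v * (x v)\<^sup>2"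
      unfolding W using fin notin uv(3) by (auto simp: T_def S_def \<tau>_def)
    show ?thesis
    \<comment> \<open>If \<open>\<tau> = 0\<close>, both weights vanish and the endpoint inequality
      \<open>IH\<close> is already the claim.\<close>
    proof (cases "\<tau> = 0")
      case True
      then have "a u * y u = 0" "a v * y v = 0"
        using au av yu yv unfolding \<tau>_def by (auto simp: add_nonneg_eq_0_iff)
      then have "y u = 0" "y v = 0" using au av by auto
      then show ?thesis using IH[of u] True unfolding F T' S' by simp
    next
      case False
      then have \<tau>: "\<tau> > 0" using \<tau>0 by simp
      \<comment> \<open>The endpoint inequalities are combined with the coefficients
        \<open>a u * y u\<close> and \<open>a v * y v\<close>, whose sum is \<open>\<tau>\<close>;
        the outcome is \<open>\<tau>\<close> times the claim.\<close>
      have "a u * y u * (R + 2 * (\<tau> / a u) * N u) + a v * y v * (R + 2 * (\<tau> / a v) * N v)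
          \<le> a u * y u * (4 * (T + \<tau>) * (S + \<tau> / a u * (x u)\<^sup>2))
          + a v * y v * (4 * (T + \<tau>) * (S + \<tau> / a v * (x v)\<^sup>2))"
        using au av yu yv by (intro add_mono mult_left_mono IH) auto
      also have "a u * y u * (R + 2 * (\<tau> / a u) * N u) + a v * y v * (R + 2 * (\<tau> / a v) * N v)
          = (a u * y u + a v * y v) * R + \<tau> * (2 * y u * N u + 2 * y v * N v)"
        using au av by (simp add: field_simps)
      also have "a u * y u * (4 * (T + \<tau>) * (S + \<tau> / a u * (x u)\<^sup>2))
          + a v * y v * (4 * (T + \<tau>) * (S + \<tau> / a v * (x v)\<^sup>2)) =
          4 * (T + \<tau>) * ((a u * y u + a v * y v) * S + \<tau> * (y u * (x u)\<^sup>2 + y v * (x v)\<^sup>2))"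
        using au av by (simp add: field_simps)
      finally have "\<tau> * (R + 2 * y u * N u + 2 * y v * N v) \<le>
          \<tau> * (4 * (T + \<tau>) * (S + y u * (x u)\<^sup>2 + y v * (x v)\<^sup>2))"
        unfolding \<tau>_def[symmetric] by (simp add: algebra_simps)
      then show ?thesis using \<tau> unfolding F T' S' by simp
    qed
  qed
qed

text \<open>A nonzero linear term would dominate for small \<open>t\<close> of the right sign;
  \<open>t = b / k\<close> with a positive \<open>k > c\<close> makes this explicit.\<close>

lemma linear_coeff_eq_0:
  fixes b c :: real
  assumes "\<And>t. b * t \<le> c * t\<^sup>2"
  shows "b = 0"
proof (rule ccontr)
  assume "b \<noteq> 0"
  define k where "k = 1 + \<bar>c\<bar>"
  have k: "k > 0" "c < k" by (auto simp: k_def)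
  have "b * (b / k) \<le> c * (b / k)\<^sup>2" by (rule assms)
  then have "k * b\<^sup>2 \<le> c * b\<^sup>2" using k by (simp add: power2_eq_square field_simps)
  moreover have "c * b\<^sup>2 < k * b\<^sup>2" using k \<open>b \<noteq> 0\<close> by simp
  ultimately show False by simp
qed

text \<open>One factor of \<open>(x u + x v)^2\<close> is split into \<open>x u\<close> and
  \<open>x v\<close>. By symmetry both halves agree, and in each the inner sum is the left side of
  the eigenvalue equation.\<close>

lemma edge_form_eigenfunction:
  assumes sym: "\<And>u v. E u v \<Longrightarrow> E v u"
    and eig: "\<And>v. v \<in> V \<Longrightarrow> (\<Sum>w\<in>V. of_bool (E v w) * (x v + x w)) = q * x v"
  shows "edge_form V E (\<lambda>_. 1) x = 2 * q * (\<Sum>v\<in>V. (x v)\<^sup>2)"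
proof -
  have "edge_form V E (\<lambda>_. 1) x = (\<Sum>u\<in>V. \<Sum>v\<in>V. x u * (of_bool (E u v) * (x u + x v)))
      + (\<Sum>u\<in>V. \<Sum>v\<in>V. x v * (of_bool (E u v) * (x u + x v)))"
    unfolding edge_form_def sum.distrib[symmetric]
    by (intro sum.cong refl) (simp add: power2_eq_square algebra_simps)
  also have "(\<Sum>u\<in>V. \<Sum>v\<in>V. x v * (of_bool (E u v) * (x u + x v))) =
      (\<Sum>u\<in>V. \<Sum>v\<in>V. x u * (of_bool (E u v) * (x u + x v)))"
    by (subst sum.swap, intro sum.cong refl) (use sym in \<open>auto simp: add.commute of_bool_def\<close>)
  also have "(\<Sum>u\<in>V. \<Sum>v\<in>V. x u * (of_bool (E u v) * (x u + x v))) = q * (\<Sum>v\<in>V. (x v)\<^sup>2)"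
    by (simp add: sum_distrib_left[symmetric] eig) (simp add: sum_distrib_left power2_eq_square mult_ac)
  finally show ?thesis by simp
qed

section \<open>Extremal functions\<close>

text \<open>These are the properties of \<open>a v = 1 - 1 / c v\<close> on which the variational
  argument rests. Positivity permits division by \<open>a v\<close> when weights are moved, and
  \<open>a_le_1\<close> keeps the perturbation in \<open>extremal_nonadjacent_trans\<close> between
  -1 and 1.\<close>

locale clique_weighted_graph =
  fixes V :: "'a set" and E :: "'a \<Rightarrow> 'a \<Rightarrow> bool" and a :: "'a \<Rightarrow> real"
  assumes finite_V: "finite V"
    and sym: "E u v \<Longrightarrow> E v u" and irrefl: "\<not> E u u"
    and a_pos: "v \<in> V \<Longrightarrow> 0 < a v" and a_le_1: "v \<in> V \<Longrightarrow> a v \<le> 1"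
    and clique_weight: "K \<subseteq> V \<Longrightarrow> pairwise E K \<Longrightarrow> v \<in> K \<Longrightarrow>
      1 - 1 / real (card K) \<le> a v"
begin

lemma edge_form_bound:
  assumes "\<And>v. v \<in> V \<Longrightarrow> 0 \<le> y v"
  shows "edge_form V E y x \<le> 4 * (\<Sum>v\<in>V. a v * y v) * (\<Sum>v\<in>V. y v * (x v)\<^sup>2)"
  by (rule edge_form_le[OF finite_V sym irrefl a_pos clique_weight assms])

lemma edge_form_bound_1: "edge_form V E (\<lambda>_. 1) x \<le> 4 * (\<Sum>v\<in>V. a v) * (\<Sum>v\<in>V. (x v)\<^sup>2)"
  using edge_form_bound[of "\<lambda>_. 1" x] by simp

text \<open>By the triangle inequality absolute values can only enlarge the form, while the
  right-hand side stays the same and remains an upper bound.\<close>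

lemma extremal_abs:
  assumes "edge_form V E (\<lambda>_. 1) x = 4 * (\<Sum>v\<in>V. a v) * (\<Sum>v\<in>V. (x v)\<^sup>2)"
  shows "edge_form V E (\<lambda>_. 1) (\<lambda>v. \<bar>x v\<bar>) = 4 * (\<Sum>v\<in>V. a v) * (\<Sum>v\<in>V. \<bar>x v\<bar>\<^sup>2)"
proof -
  have "edge_form V E (\<lambda>_. 1) x \<le> edge_form V E (\<lambda>_. 1) (\<lambda>v. \<bar>x v\<bar>)"
    unfolding edge_form_def
    by (intro sum_mono mult_left_mono abs_le_square_iff[THEN iffD1]) auto
  then show ?thesis using edge_form_bound_1[of "\<lambda>v. \<bar>x v\<bar>"] assms by simp
qed

text \<open>First variation in the function: an extremal function is an eigenfunction.\<close>

lemma extremal_eigenfunction: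
  assumes ext: "edge_form V E (\<lambda>_. 1) x = 4 * (\<Sum>v\<in>V. a v) * (\<Sum>v\<in>V. (x v)\<^sup>2)" and v: "v \<in> V"
  shows "(\<Sum>w\<in>V. of_bool (E v w) * (x v + x w)) = 2 * (\<Sum>v\<in>V. a v) * x v"
proof -
  define T where "T = (\<Sum>v\<in>V. a v)"
  define W where "W = V - {v}"
  have V: "V = insert v W" "v \<notin> W" "finite W" using v finite_V by (auto simp: W_def)
  define b where "b = (\<Sum>w\<in>W. of_bool (E v w) * (x v + x w))"
  define d where "d = (\<Sum>w\<in>W. of_bool (E v w) :: real)"
  \<comment> \<open>Moving \<open>x v\<close> by \<open>t\<close> adds
    \<open>4 * t * b + 2 * t^2 * d\<close> to the form and \<open>2 * t * x v + t^2\<close> to the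
    sum of squares. The bound holds for every real \<open>t\<close>, so the linear terms must
    cancel.\<close>
  have "(4 * b - 8 * T * x v) * t \<le> (4 * T - 2 * d) * t\<^sup>2" for t
  proof -
    define x' where "x' = x(v := x v + t)"
    have cW: "edge_form W E (\<lambda>_. 1) x' = edge_form W E (\<lambda>_. 1) x"
      by (rule edge_form_cong) (use V in \<open>auto simp: x'_def\<close>)
    have sW: "(\<Sum>w\<in>W. (x' w)\<^sup>2) = (\<Sum>w\<in>W. (x w)\<^sup>2)"
      by (intro sum.cong refl) (use V in \<open>auto simp: x'_def\<close>)
    have "(\<Sum>w\<in>W. of_bool (E v w) * (x' v + x' w)\<^sup>2) =
        (\<Sum>w\<in>W. of_bool (E v w) * (x v + x w)\<^sup>2 + (2 * t) * (of_bool (E v w) * (x v + x w))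
          + t\<^sup>2 * of_bool (E v w))"
      by (intro sum.cong refl) (use V in \<open>auto simp: x'_def power2_eq_square algebra_simps\<close>)
    also have "\<dots> = (\<Sum>w\<in>W. of_bool (E v w) * (x v + x w)\<^sup>2) + 2 * t * b + t\<^sup>2 * d"
      by (simp only: sum.distrib sum_distrib_left[symmetric] b_def d_def)
    finally have "edge_form V E (\<lambda>_. 1) x' = edge_form V E (\<lambda>_. 1) x + 4 * t * b + 2 * t\<^sup>2 * d"
      unfolding V(1) by (simp add: edge_form_insert[OF V(3,2) sym irrefl] cW)
    moreover have "(\<Sum>w\<in>V. (x' w)\<^sup>2) = (\<Sum>w\<in>V. (x w)\<^sup>2) + 2 * t * x v + t\<^sup>2"
      using V(2,3) unfolding V(1) by (simp add: sW) (simp add: x'_def power2_eq_square algebra_simps)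
    ultimately show ?thesis
      using edge_form_bound_1[of x'] ext unfolding T_def[symmetric] by (simp add: algebra_simps)
  qed
  then have "4 * b - 8 * T * x v = 0" by (rule linear_coeff_eq_0)
  moreover have "(\<Sum>w\<in>V. of_bool (E v w) * (x v + x w)) = b"
    unfolding V(1) using V(2,3) irrefl by (simp add: b_def)
  ultimately show ?thesis by (simp add: T_def)
qed

text \<open>Second variation in the weights: the linear terms of the perturbations \<open>1 + d\<close> and \<open>1 - d\<close> cancel.\<close>

lemma extremal_edge_form_nonpos:
  assumes ext: "edge_form V E (\<lambda>_. 1) x = 4 * (\<Sum>v\<in>V. a v) * (\<Sum>v\<in>V. (x v)\<^sup>2)"
    and d: "\<And>v. v \<in> V \<Longrightarrow> \<bar>d v\<bar> \<le> 1" and 0: "(\<Sum>v\<in>V. a v * d v) = 0"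
  shows "edge_form V E d x \<le> 0"
proof -
  define T where "T = (\<Sum>v\<in>V. a v)"
  have "edge_form V E (\<lambda>v. 1 + d v) x + edge_form V E (\<lambda>v. 1 - d v) x =
      2 * edge_form V E (\<lambda>_. 1) x + 2 * edge_form V E d x"
    unfolding edge_form_def sum.distrib[symmetric] sum_distrib_left
    by (intro sum.cong refl) (simp add: algebra_simps)
  \<comment> \<open>Both \<open>1 + d\<close> and \<open>1 - d\<close> are nonnegative, and the
    hypothesis \<open>0\<close> leaves the factor \<open>T\<close> unchanged, so the right-hand
    sides contribute no quadratic term in \<open>d\<close>.\<close>
  moreover have "edge_form V E (\<lambda>v. 1 + d v) x \<le> 4 * T * (\<Sum>v\<in>V. (1 + d v) * (x v)\<^sup>2)"
    using edge_form_bound[of "\<lambda>v. 1 + d v" x] d 0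
    by (force simp: T_def algebra_simps sum.distrib abs_le_iff)
  moreover have "edge_form V E (\<lambda>v. 1 - d v) x \<le> 4 * T * (\<Sum>v\<in>V. (1 - d v) * (x v)\<^sup>2)"
    using edge_form_bound[of "\<lambda>v. 1 - d v" x] d 0
    by (force simp: T_def algebra_simps sum_subtractf abs_le_iff)
  moreover have "4 * T * (\<Sum>v\<in>V. (1 + d v) * (x v)\<^sup>2) + 4 * T * (\<Sum>v\<in>V. (1 - d v) * (x v)\<^sup>2)
      = 2 * (4 * T * (\<Sum>v\<in>V. (x v)\<^sup>2))"
    by (simp add: algebra_simps sum.distrib sum_subtractf)
  ultimately show ?thesis using ext unfolding T_def by linarith
qed

text \<open>Weight is moved from \<open>v\<close> to \<open>u\<close> and \<open>w\<close>. If
  \<open>u\<close> and \<open>w\<close> were adjacent, theirs would be the only edge inside the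
  support of the perturbation, and the second variation would be positive.\<close>

lemma extremal_nonadjacent_trans:
  assumes ext: "edge_form V E (\<lambda>_. 1) x = 4 * (\<Sum>v\<in>V. a v) * (\<Sum>v\<in>V. (x v)\<^sup>2)"
    and V: "u \<in> V" "v \<in> V" "w \<in> V" and nonadj: "\<not> E u v" "\<not> E v w" and "x u + x w \<noteq> 0"
  shows "\<not> E u w"
proof
  assume uw: "E u w"
  have ne: "u \<noteq> v" "v \<noteq> w" "u \<noteq> w" using uw nonadj irrefl sym by auto
  have wu: "E w u" and nonadj': "\<not> E v u" "\<not> E w v" using uw nonadj sym by auto
  \<comment> \<open>The direction \<open>e_u / a u + e_w / a w - 2 * e_v / a v\<close> is multiplied
    by \<open>a u * a v * a w / 2\<close>, which clears the denominators and bounds every entry by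
    1.\<close>
  define d where "d = (\<lambda>z. if z = u then a v * a w / 2 else if z = w then a u * a v / 2
    else if z = v then - (a u * a w) else 0)"
  have le: "a s * a t \<le> 1" "0 < a s * a t" if "s \<in> V" "t \<in> V" for s t
    using that a_pos a_le_1 by (auto intro!: mult_le_one simp: less_imp_le)
  have "edge_form V E d x \<le> 0"
  proof (rule extremal_edge_form_nonpos[OF ext])
    show "\<bar>d z\<bar> \<le> 1" for z
      using le[of v w] le[of u v] le[of u w] V by (auto simp: d_def)
    have "(\<Sum>z\<in>V. a z * d z) = (\<Sum>z\<in>{u,v,w}. a z * d z)"
      by (rule sum.mono_neutral_right) (use V finite_V in \<open>auto simp: d_def\<close>)
    also have "\<dots> = 0" using ne by (simp add: d_def)
    finally show "(\<Sum>z\<in>V. a z * d z) = 0" .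
  qed
  moreover have "edge_form V E d x = 2 * (d u * d w * (x u + x w)\<^sup>2)"
  proof -
    have "edge_form V E d x = (\<Sum>s\<in>{u,v,w}. \<Sum>t\<in>V. of_bool (E s t) * (d s * d t * (x s + x t)\<^sup>2))"
      unfolding edge_form_def
      by (rule sum.mono_neutral_right) (use V finite_V in \<open>auto simp: d_def\<close>)
    also have "\<dots> = (\<Sum>s\<in>{u,v,w}. \<Sum>t\<in>{u,v,w}. of_bool (E s t) * (d s * d t * (x s + x t)\<^sup>2))"
      by (intro sum.cong refl sum.mono_neutral_right) (use V finite_V in \<open>auto simp: d_def\<close>)
    also have "\<dots> = 2 * (d u * d w * (x u + x w)\<^sup>2)"
      using ne uw wu nonadj nonadj' irrefl by (simp add: algebra_simps)
    finally show ?thesis .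
  qed
  moreover have "d u * d w * (x u + x w)\<^sup>2 > 0"
    using le(2)[of v w] le(2)[of u v] V ne assms(7) by (auto simp: d_def intro!: mult_pos_pos)
  ultimately show False by simp
qed

text \<open>Equality gives \<open>4 * (n * b) * S <= Z + 4 * (b * X) * X\<close>, which the identity
  \<open>Z = 2 * (n * S - X^2)\<close> turns into \<open>(2 * b - 1) * Z <= 0\<close>. At
  \<open>b = 1 / 2\<close> this says nothing, and unbalanced complete bipartite graphs indeed have
  nonconstant extremal functions.\<close>

lemma extremal_constant:
  assumes ext: "edge_form V E (\<lambda>_. 1) x = 4 * (\<Sum>v\<in>V. a v) * (\<Sum>v\<in>V. (x v)\<^sup>2)"
    and x: "\<And>v. v \<in> V \<Longrightarrow> 0 \<le> x v" and a: "\<And>v. v \<in> V \<Longrightarrow> a v = b" and b: "1 / 2 < b"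
    and V: "u \<in> V" "v \<in> V"
  shows "x u = x v"
proof -
  define X S where "X = (\<Sum>v\<in>V. x v)" and "S = (\<Sum>v\<in>V. (x v)\<^sup>2)"
  define n where "n = real (card V)"
  define Z where "Z = (\<Sum>u\<in>V. \<Sum>v\<in>V. (x u - x v)\<^sup>2)"
  have Z: "Z = 2 * (n * S - X\<^sup>2)"
    using sum_sum_weighted_square_diff[of "\<lambda>_. 1" x V] by (simp add: Z_def S_def X_def n_def)
  \<comment> \<open>The squared differences are extended from adjacent pairs to all pairs.\<close>
  have "edge_form V E (\<lambda>_. 1) x \<le> Z + edge_form V E x (\<lambda>_. 1)"
    unfolding Z_def edge_form_def sum.distrib[symmetric]
    by (intro sum_mono) (auto simp: power2_sum power2_diff sum_squares_bound)
  \<comment> \<open>Now \<open>x\<close> plays the part of the weights and the function is constant: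
    this is the Motzkin-Straus bound.\<close>
  moreover have "edge_form V E x (\<lambda>_. 1) \<le> 4 * (b * X) * X"
    using edge_form_bound[OF x, where x = "\<lambda>_. 1"] by (simp add: a X_def sum_distrib_left)
  moreover have "(\<Sum>v\<in>V. a v) = n * b" using a by (simp add: n_def)
  ultimately have "4 * (n * b) * S \<le> Z + 4 * (b * X) * X" using ext unfolding S_def by simp
  then have "(2 * b - 1) * Z \<le> 0" unfolding Z by (simp add: power2_eq_square algebra_simps)
  then have "Z \<le> 0" using b by (simp add: mult_le_0_iff)
  moreover have "Z \<ge> (x u - x v)\<^sup>2"
  proof -
    have "(x u - x v)\<^sup>2 \<le> (\<Sum>v\<in>V. (x u - x v)\<^sup>2)"
      using V finite_V by (intro member_le_sum) auto
    also have "\<dots> \<le> Z" unfolding Z_def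
      using V finite_V by (intro member_le_sum[of u V "\<lambda>u. \<Sum>v\<in>V. (x u - x v)\<^sup>2"]) (auto intro: sum_nonneg)
    finally show ?thesis .
  qed
  ultimately have "(x u - x v)\<^sup>2 \<le> 0" by linarith
  then show ?thesis by simp
qed

end

section \<open>The spectrum of the signless Laplacian\<close>

text \<open>Ensures that the maximum defining \<open>Q_index\<close> is taken over a nonempty set. A
  complex eigenvalue exists, symmetry makes it real, and it is then a root of the real
  characteristic polynomial.\<close>

lemma real_symmetric_spectrum_nonempty:
  fixes A :: "real mat"
  assumes A: "A \<in> carrier_mat n n" and "n > 0"
    and sym: "\<And>i j. i < n \<Longrightarrow> j < n \<Longrightarrow> A $$ (i, j) = A $$ (j, i)"
  shows "spectrum A \<noteq> {}"
proof -
  define B where "B = map_mat complex_of_real A"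
  have B: "B \<in> carrier_mat n n" using A by (simp add: B_def)
  obtain k where k: "k \<in> spectrum B" using spectrum_non_empty[OF B \<open>n > 0\<close>] by blast
  then obtain v where v: "v \<in> carrier_vec n" "v \<noteq> 0\<^sub>v n" "B *\<^sub>v v = k \<cdot>\<^sub>v v"
    using B unfolding spectrum_def eigenvalue_def eigenvector_def by auto
  have row: "(\<Sum>j<n. of_real (A $$ (i, j)) * v $ j) = k * v $ i" if "i < n" for i
    using arg_cong[OF v(3), of "\<lambda>w. w $ i"] that A v(1)
    by (simp add: B_def mult_mat_vec_def scalar_prod_def lessThan_atLeast0)
  define N where "N = (\<Sum>i<n. (cmod (v $ i))\<^sup>2)"
  \<comment> \<open>The Hermitian form at \<open>v\<close> equals \<open>k * N\<close>, and
    exchanging its two summation indices shows that it is its own conjugate.\<close>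
  define s where "s = (\<Sum>i<n. \<Sum>j<n. cnj (v $ i) * (of_real (A $$ (i, j)) * v $ j))"
  have "s = (\<Sum>i<n. cnj (v $ i) * (k * v $ i))"
    unfolding s_def by (intro sum.cong refl) (simp add: sum_distrib_left[symmetric] row)
  also have "\<dots> = k * of_real N"
    unfolding N_def of_real_sum sum_distrib_left
    by (intro sum.cong refl) (simp add: complex_norm_square mult_ac del: of_real_power)
  finally have s: "s = k * of_real N" .
  have "cnj s = s"
    unfolding s_def cnj_sum by (subst sum.swap, intro sum.cong refl) (simp add: sym mult_ac)
  then have "cnj k * of_real N = k * of_real N" unfolding s by simp
  moreover have "N \<noteq> 0"
  proof
    assume "N = 0"
    then have "\<forall>i<n. v $ i = 0" unfolding N_def by (subst (asm) sum_nonneg_eq_0_iff) auto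
    then have "v = 0\<^sub>v n" using v(1) by (intro eq_vecI) auto
    then show False using v(2) by simp
  qed
  ultimately have "cnj k = k" by simp
  then have "k = of_real (Re k)" by (metis Reals_cnj_iff of_real_Re)
  moreover have "poly (char_poly B) k = 0" using k spectrum_root_char_poly[OF B] by auto
  ultimately have "poly (map_poly of_real (char_poly A)) (complex_of_real (Re k)) = 0"
    unfolding B_def of_real_hom.char_poly_hom[OF A] by simp
  then have "poly (char_poly A) (Re k) = 0" by simp
  then show ?thesis using spectrum_root_char_poly[OF A] by auto
qed

section \<open>Eigenvectors as functions on the vertices\<close>

lemma (in graph) out_degree_eq_card: "out_degree G v = card {w. v \<rightarrow>\<^bsub>G\<^esub> w}"
proof -
  have "inj_on (head G) (out_arcs G v)"
    by (intro inj_onI no_multi_arcs) (auto simp: arc_to_ends_def)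
  moreover have "head G ` out_arcs G v = {w. v \<rightarrow>\<^bsub>G\<^esub> w}"
    by (auto simp: arcs_ends_def arc_to_ends_def image_iff)
  ultimately show ?thesis unfolding out_degree_def by (metis card_image)
qed

lemma (in graph) out_degree_eq_sum: "real (out_degree G v) = (\<Sum>w\<in>verts G. of_bool (v \<rightarrow>\<^bsub>G\<^esub> w))"
proof -
  have "{w. v \<rightarrow>\<^bsub>G\<^esub> w} = {w \<in> verts G. v \<rightarrow>\<^bsub>G\<^esub> w}" by (auto dest: adj_in_verts)
  then show ?thesis by (simp add: out_degree_eq_card sum.If_cases of_bool_def Int_def)
qed

text \<open>The degree term is distributed over the neighbours, one \<open>x v\<close> for each.
  Functions on vertices remove the enumeration \<open>vs\<close>; their values outside
  \<open>verts G\<close> are unconstrained.\<close>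

definition Q_eigenfunction :: "('a, 'b) pre_digraph \<Rightarrow> real \<Rightarrow> ('a \<Rightarrow> real) \<Rightarrow> bool" where
  "Q_eigenfunction G q x \<longleftrightarrow> (\<exists>v\<in>verts G. x v \<noteq> 0) \<and>
    (\<forall>v\<in>verts G. (\<Sum>w\<in>verts G. of_bool (v \<rightarrow>\<^bsub>G\<^esub> w) * (x v + x w)) = q * x v)"

lemma (in graph) signless_laplacian_eigenvalue_iff:
  assumes vs: "distinct vs" "set vs = verts G"
  shows "eigenvalue (signless_laplacian G vs) q \<longleftrightarrow> (\<exists>x. Q_eigenfunction G q x)"
proof -
  define n where "n = length vs"
  have bij: "bij_betw ((!) vs) {..<n} (verts G)"
    using bij_betw_nth[OF vs(1)] vs(2) n_def by blast
  have all_iff: "(\<forall>v\<in>verts G. R v) \<longleftrightarrow> (\<forall>i<n. R (vs ! i))" for R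
    unfolding bij_betw_imp_surj_on[OF bij, symmetric] by auto
  have carrier: "signless_laplacian G vs \<in> carrier_mat n n"
    by (simp add: signless_laplacian_def degree_mat_def adjacency_mat_def n_def)
  have eq: "(signless_laplacian G vs *\<^sub>v vec n (\<lambda>i. x (vs ! i)) = q \<cdot>\<^sub>v vec n (\<lambda>i. x (vs ! i))) \<longleftrightarrow>
      (\<forall>v\<in>verts G. (\<Sum>w\<in>verts G. of_bool (v \<rightarrow>\<^bsub>G\<^esub> w) * (x v + x w)) = q * x v)" for x
  proof -
    have "(signless_laplacian G vs *\<^sub>v vec n (\<lambda>i. x (vs ! i))) $ i =
        (\<Sum>w\<in>verts G. of_bool (vs ! i \<rightarrow>\<^bsub>G\<^esub> w) * (x (vs ! i) + x w))" if i: "i < n" for i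
    proof -
      have "(signless_laplacian G vs *\<^sub>v vec n (\<lambda>i. x (vs ! i))) $ i =
          (\<Sum>j<n. signless_laplacian G vs $$ (i, j) * x (vs ! j))"
        using i carrier by (simp add: scalar_prod_def lessThan_atLeast0)
      also have "\<dots> = (\<Sum>j<n. (if i = j then real (out_degree G (vs ! i)) * x (vs ! j) else 0)
            + of_bool (vs ! i \<rightarrow>\<^bsub>G\<^esub> vs ! j) * x (vs ! j))"
        using i by (intro sum.cong refl) (auto simp: n_def mat_diag_def distrib_right
            signless_laplacian_def degree_mat_def adjacency_mat_def)
      also have "\<dots> = real (out_degree G (vs ! i)) * x (vs ! i)
          + (\<Sum>j<n. of_bool (vs ! i \<rightarrow>\<^bsub>G\<^esub> vs ! j) * x (vs ! j))"
        using i by (simp add: sum.distrib)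
      also have "(\<Sum>j<n. of_bool (vs ! i \<rightarrow>\<^bsub>G\<^esub> vs ! j) * x (vs ! j)) =
          (\<Sum>w\<in>verts G. of_bool (vs ! i \<rightarrow>\<^bsub>G\<^esub> w) * x w)"
        by (rule sum.reindex_bij_betw[OF bij])
      finally show ?thesis
        by (simp add: out_degree_eq_sum distrib_left sum.distrib sum_distrib_right)
    qed
    then have "(signless_laplacian G vs *\<^sub>v vec n (\<lambda>i. x (vs ! i)) = q \<cdot>\<^sub>v vec n (\<lambda>i. x (vs ! i))) \<longleftrightarrow>
      (\<forall>i<n. (\<Sum>w\<in>verts G. of_bool (vs ! i \<rightarrow>\<^bsub>G\<^esub> w) * (x (vs ! i) + x w)) = q * x (vs ! i))"
      using carrier by (simp add: vec_eq_iff)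
    also have "\<dots> \<longleftrightarrow> (\<forall>v\<in>verts G. (\<Sum>w\<in>verts G. of_bool (v \<rightarrow>\<^bsub>G\<^esub> w) * (x v + x w)) = q * x v)"
      by (rule all_iff[symmetric])
    finally show ?thesis .
  qed
  have ne: "vec n (\<lambda>i. x (vs ! i)) \<noteq> 0\<^sub>v n \<longleftrightarrow> (\<exists>v\<in>verts G. x v \<noteq> 0)" for x :: "'a \<Rightarrow> real"
    using all_iff[of "\<lambda>v. x v = 0"] by (auto simp: vec_eq_iff)
  \<comment> \<open>Every vector comes from a vertex function, obtained by inverting the
    enumeration.\<close>
  have surj: "\<exists>x. v = vec n (\<lambda>i. x (vs ! i))" if "v \<in> carrier_vec n" for v :: "real vec"
  proof -
    have "v = vec n (\<lambda>i. v $ the_inv_into {..<n} ((!) vs) (vs ! i))"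
      using that bij by (auto simp: the_inv_into_f_f bij_betw_def intro!: eq_vecI)
    then show ?thesis by (intro exI[of _ "\<lambda>w. v $ the_inv_into {..<n} ((!) vs) w"])
  qed
  have "eigenvalue (signless_laplacian G vs) q \<longleftrightarrow> (\<exists>x. vec n (\<lambda>i. x (vs ! i)) \<noteq> 0\<^sub>v n \<and>
      signless_laplacian G vs *\<^sub>v vec n (\<lambda>i. x (vs ! i)) = q \<cdot>\<^sub>v vec n (\<lambda>i. x (vs ! i)))"
    unfolding eigenvalue_def eigenvector_def using carrier surj by (metis carrier_matD(1) vec_carrier)
  then show ?thesis unfolding eq ne Q_eigenfunction_def .
qed

lemma (in graph)
  assumes vs: "distinct vs" "set vs = verts G" and ne: "verts G \<noteq> {}"
  shows Q_index_eigenfunction: "\<exists>x. Q_eigenfunction G (Q_index G vs) x"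
    and Q_index_ge: "Q_eigenfunction G q x \<Longrightarrow> q \<le> Q_index G vs"
proof -
  have carrier: "signless_laplacian G vs \<in> carrier_mat (length vs) (length vs)"
    by (simp add: signless_laplacian_def degree_mat_def adjacency_mat_def)
  have "u \<rightarrow>\<^bsub>G\<^esub> v \<longleftrightarrow> v \<rightarrow>\<^bsub>G\<^esub> u" for u v using sym_arcs by (auto simp: symmetric_def dest: symD)
  then have "spectrum (signless_laplacian G vs) \<noteq> {}"
    using vs ne
    by (intro real_symmetric_spectrum_nonempty[OF carrier])
      (auto simp: signless_laplacian_def degree_mat_def adjacency_mat_def mat_diag_def)
  moreover have fin: "finite (spectrum (signless_laplacian G vs))"
    by (rule card_finite_spectrum[OF carrier])
  ultimately have "Q_index G vs \<in> spectrum (signless_laplacian G vs)"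
    unfolding Q_index_def by (rule Max_in[rotated])
  then show "\<exists>x. Q_eigenfunction G (Q_index G vs) x"
    using signless_laplacian_eigenvalue_iff[OF vs] by (simp add: spectrum_def)
  show "q \<le> Q_index G vs" if "Q_eigenfunction G q x"
    unfolding Q_index_def using that fin signless_laplacian_eigenvalue_iff[OF vs]
    by (intro Max_ge) (auto simp: spectrum_def)
qed

section \<open>Cliques and complete multipartite graphs\<close>

lemma (in graph) adj_sym: "u \<rightarrow>\<^bsub>G\<^esub> v \<Longrightarrow> v \<rightarrow>\<^bsub>G\<^esub> u"
  using sym_arcs by (rule arcs_ends_symmetric)

lemma (in graph) adj_irrefl: "\<not> u \<rightarrow>\<^bsub>G\<^esub> u"
  using no_loops by (auto simp: arcs_ends_conv)

text \<open>Connectedness is defined through the symmetric closure, which has the same reachability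
  as \<open>G\<close> because the arcs are symmetric.\<close>

lemma (in graph) connected_induct:
  assumes "Digraph_Component.connected G" "v \<in> verts G" "w \<in> verts G"
    and "P v" and "\<And>x y. P x \<Longrightarrow> x \<rightarrow>\<^bsub>G\<^esub> y \<Longrightarrow> P y"
  shows "P w"
proof -
  have "v \<rightarrow>\<^sup>*\<^bsub>G\<^esub> w"
    using assms(1-3) reachable_mk_symmetric_eq[OF sym_arcs]
    by (auto simp: Digraph_Component.connected_def strongly_connected_def)
  then show ?thesis using assms(4,5) by (induction rule: reachable_induct) auto
qed

text \<open>The subgraph induced on a clique is a complete digraph, so cliques can be handled as
  vertex sets from here on.\<close>

lemma (in graph) complete_subgraph_iff:
  "(\<exists>H. subgraph H G \<and> complete_digraph k H \<and> verts H = K) \<longleftrightarrow>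
    K \<subseteq> verts G \<and> pairwise (dominates G) K \<and> card K = k"
proof
  assume "\<exists>H. subgraph H G \<and> complete_digraph k H \<and> verts H = K"
  then obtain H where H: "subgraph H G" "complete_digraph k H" "verts H = K" by blast
  moreover have "arcs_ends H \<subseteq> arcs_ends G"
    using H(1) by (auto simp: subgraph_def compatible_def arcs_ends_conv)
  ultimately show "K \<subseteq> verts G \<and> pairwise (dominates G) K \<and> card K = k"
    by (auto simp: complete_digraph_def subgraph_def pairwise_def)
next
  assume K: "K \<subseteq> verts G \<and> pairwise (dominates G) K \<and> card K = k"
  have sub: "subgraph (G \<restriction> K) G" using K by (intro induced_imp_subgraph induced_induce) auto
  have ends: "arcs_ends (G \<restriction> K) = {(u, v). (u, v) \<in> K \<times> K \<and> u \<noteq> v}"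
    using K no_loops by (fastforce simp: arcs_ends_conv pairwise_def)
  have "graph (G \<restriction> K)"
  proof -
    interpret H: wf_digraph "G \<restriction> K" using sub by (simp add: subgraph_def)
    show ?thesis
    proof unfold_locales
      show "finite (verts (G \<restriction> K))" using K finite_subset[of K] by auto
      show "symmetric (G \<restriction> K)" unfolding symmetric_def ends by (auto intro: symI)
    qed (auto dest: no_loops intro: no_multi_arcs simp: arc_to_ends_def)
  qed
  then have "complete_digraph k (G \<restriction> K)" using K ends by (simp add: complete_digraph_def)
  then show "\<exists>H. subgraph H G \<and> complete_digraph k H \<and> verts H = K" using sub by auto
qed

lemma (in graph) clique_number_eq:
  "clique_number G = Max (card ` {K. K \<subseteq> verts G \<and> pairwise (dominates G) K})"
proof -
  have "{k. \<exists>H. subgraph H G \<and> complete_digraph k H} =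
      {k. \<exists>K. \<exists>H. subgraph H G \<and> complete_digraph k H \<and> verts H = K}" by simp
  also have "\<dots> = card ` {K. K \<subseteq> verts G \<and> pairwise (dominates G) K}"
    unfolding complete_subgraph_iff by auto
  finally show ?thesis by (simp add: clique_number_def)
qed

lemma (in graph) vertex_clique_number_eq:
  "vertex_clique_number G v = Max (card ` {K. K \<subseteq> verts G \<and> pairwise (dominates G) K \<and> v \<in> K})"
proof -
  have "{k. \<exists>H. subgraph H G \<and> complete_digraph k H \<and> v \<in> verts H} =
      {k. \<exists>K. v \<in> K \<and> (\<exists>H. subgraph H G \<and> complete_digraph k H \<and> verts H = K)}" by auto
  also have "\<dots> = card ` {K. K \<subseteq> verts G \<and> pairwise (dominates G) K \<and> v \<in> K}"
    unfolding complete_subgraph_iff by auto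
  finally show ?thesis by (simp add: vertex_clique_number_def)
qed

lemma (in graph) clique_number_ge:
  assumes "K \<subseteq> verts G" "pairwise (dominates G) K"
  shows "card K \<le> clique_number G"
  unfolding clique_number_eq using assms by (intro Max_ge) auto

lemma (in graph) clique_numberE:
  obtains K where "K \<subseteq> verts G" "pairwise (dominates G) K" "card K = clique_number G"
proof -
  have "clique_number G \<in> card ` {K. K \<subseteq> verts G \<and> pairwise (dominates G) K}"
    unfolding clique_number_eq by (intro Max_in) auto
  then show ?thesis using that by auto
qed

lemma (in graph) vertex_clique_number_ge:
  assumes "K \<subseteq> verts G" "pairwise (dominates G) K" "v \<in> K"
  shows "card K \<le> vertex_clique_number G v"
  unfolding vertex_clique_number_eq using assms by (intro Max_ge) auto

lemma (in graph) vertex_clique_numberE: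
  assumes "v \<in> verts G"
  obtains K where "K \<subseteq> verts G" "pairwise (dominates G) K" "v \<in> K"
    "card K = vertex_clique_number G v"
proof -
  have "{v} \<in> {K. K \<subseteq> verts G \<and> pairwise (dominates G) K \<and> v \<in> K}" using assms by simp
  then have "vertex_clique_number G v \<in>
      card ` {K. K \<subseteq> verts G \<and> pairwise (dominates G) K \<and> v \<in> K}"
    unfolding vertex_clique_number_eq by (intro Max_in) (simp, blast)
  then show ?thesis using that by auto
qed

lemma (in graph) vertex_clique_number_pos:
  assumes "v \<in> verts G"
  shows "1 \<le> vertex_clique_number G v"
  using vertex_clique_number_ge[of "{v}" v] assms by simp

lemma (in graph) vertex_clique_number_le:
  assumes "v \<in> verts G"
  shows "vertex_clique_number G v \<le> clique_number G"
  by (metis assms vertex_clique_numberE clique_number_ge)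

text \<open>Serves the converse of the equality statement: a Q-index of at least twice the
  right-hand side forces equality.\<close>

lemma (in graph) sum_clique_weight_le:
  "(\<Sum>v\<in>verts G. 1 - 1 / real (vertex_clique_number G v)) \<le>
    real (card (verts G)) * (1 - 1 / real (clique_number G))"
proof (rule sum_bounded_above)
  fix v assume "v \<in> verts G"
  then have "0 < vertex_clique_number G v" "vertex_clique_number G v \<le> clique_number G"
    using vertex_clique_number_pos[of v] vertex_clique_number_le[of v] by auto
  then show "1 - 1 / real (vertex_clique_number G v) \<le> 1 - 1 / real (clique_number G)"
    by (simp add: frac_le)
qed

section \<open>Complete multipartite graphs given by a partition\<close>

context graph
begin

context
  fixes P
  assumes part: "partition_on (verts G) P"
    and ends: "arcs_ends G = {(u, v). \<exists>A \<in> P. \<exists>B \<in> P. A \<noteq> B \<and> u \<in> A \<and> v \<in> B}"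
begin

lemma multipartite_part_unique: "A \<in> P \<Longrightarrow> B \<in> P \<Longrightarrow> v \<in> A \<Longrightarrow> v \<in> B \<Longrightarrow> A = B"
  using partition_onD2[OF part] by (auto simp: disjoint_def)

lemma multipartite_adj_iff:
  assumes "A \<in> P" "v \<in> A" "w \<in> verts G"
  shows "v \<rightarrow>\<^bsub>G\<^esub> w \<longleftrightarrow> w \<notin> A"
proof
  assume "v \<rightarrow>\<^bsub>G\<^esub> w"
  then obtain B C where "B \<in> P" "C \<in> P" "B \<noteq> C" "v \<in> B" "w \<in> C" unfolding ends by auto
  then show "w \<notin> A" using assms multipartite_part_unique by metis
next
  assume "w \<notin> A"
  obtain B where "B \<in> P" "w \<in> B" using assms(3) partition_onD1[OF part] by auto
  then show "v \<rightarrow>\<^bsub>G\<^esub> w" using assms(1,2) \<open>w \<notin> A\<close> unfolding ends by auto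
qed

text \<open>A clique meets each part at most once, so sending a vertex to its part is injective on
  it.\<close>

lemma multipartite_clique_card_le:
  assumes "K \<subseteq> verts G" "pairwise (dominates G) K"
  shows "card K \<le> card P"
proof -
  have "\<forall>v\<in>verts G. \<exists>A. A \<in> P \<and> v \<in> A" using partition_onD1[OF part] by blast
  then obtain f where f: "\<And>v. v \<in> verts G \<Longrightarrow> f v \<in> P \<and> v \<in> f v" by metis
  have "inj_on f K"
  proof (rule inj_onI, rule ccontr)
    fix u v assume "u \<in> K" "v \<in> K" "f u = f v" "u \<noteq> v"
    then show False using assms f[of u] f[of v] multipartite_adj_iff[of "f u" u v]
      by (auto simp: pairwise_def)
  qed
  moreover have "f ` K \<subseteq> P" using f assms(1) by blast
  moreover have "finite P" using finite_elements[OF _ part] by simp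
  ultimately show ?thesis by (rule card_inj_on_le)
qed

lemma multipartite_clique_exists:
  assumes "v \<in> verts G"
  shows "\<exists>K \<subseteq> verts G. pairwise (dominates G) K \<and> v \<in> K \<and> card K = card P"
proof -
  obtain A where A: "A \<in> P" "v \<in> A" using assms partition_onD1[OF part] by blast
  have "\<forall>B\<in>P. \<exists>w. w \<in> B" using partition_onD3[OF part] by (metis equals0I)
  then obtain g where g: "\<And>B. B \<in> P \<Longrightarrow> g B \<in> B" by metis
  \<comment> \<open>A system of representatives of the parts, changed so that \<open>v\<close>
    represents its own part.\<close>
  define f where "f = g(A := v)"
  have f: "f B \<in> B" if "B \<in> P" for B using that g A by (auto simp: f_def)
  have "inj_on f P" by (rule inj_onI) (metis f multipartite_part_unique)
  then have "card (f ` P) = card P" by (rule card_image)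
  moreover have "pairwise (dominates G) (f ` P)"
  proof (rule pairwiseI)
    fix s t assume "s \<in> f ` P" "t \<in> f ` P" "s \<noteq> t"
    then obtain B C where BC: "B \<in> P" "C \<in> P" "B \<noteq> C" and st: "s = f B" "t = f C" by auto
    show "s \<rightarrow>\<^bsub>G\<^esub> t" unfolding ends st using BC f by auto
  qed
  moreover have "f ` P \<subseteq> verts G" using f partition_onD1[OF part] by auto
  moreover have "v \<in> f ` P" using A(1) by (rule image_eqI[rotated]) (simp add: f_def)
  ultimately show ?thesis by blast
qed

lemma multipartite_vertex_clique_number:
  assumes "v \<in> verts G"
  shows "vertex_clique_number G v = card P"
proof (rule antisym)
  show "vertex_clique_number G v \<le> card P"
    by (metis assms vertex_clique_numberE multipartite_clique_card_le)
  show "card P \<le> vertex_clique_number G v"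
    by (metis assms multipartite_clique_exists vertex_clique_number_ge)
qed

lemma multipartite_clique_number:
  assumes "verts G \<noteq> {}"
  shows "clique_number G = card P"
proof (rule antisym)
  show "clique_number G \<le> card P"
    by (metis clique_numberE multipartite_clique_card_le)
  show "card P \<le> clique_number G"
    by (metis assms ex_in_conv multipartite_clique_exists clique_number_ge)
qed

lemma multipartite_out_degree:
  assumes "A \<in> P" "v \<in> A"
  shows "out_degree G v + card A = card (verts G)"
proof -
  have sub: "A \<subseteq> verts G" using assms partition_onD1[OF part] by blast
  have "{w. v \<rightarrow>\<^bsub>G\<^esub> w} = verts G - A"
    using multipartite_adj_iff[OF assms] by (auto dest: adj_in_verts)
  then show ?thesis
    using sub card_mono[OF finite_verts sub] finite_subset[OF sub]
    by (simp add: out_degree_eq_card card_Diff_subset)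
qed

end

text \<open>Nonadjacency is reflexive, as there are no loops, and symmetric; with transitivity it is
  an equivalence relation whose classes are the parts.\<close>

lemma nonadjacent_trans_multipartite:
  assumes "\<And>u v w. u \<in> verts G \<Longrightarrow> v \<in> verts G \<Longrightarrow> w \<in> verts G \<Longrightarrow> \<not> u \<rightarrow>\<^bsub>G\<^esub> v \<Longrightarrow> \<not> v \<rightarrow>\<^bsub>G\<^esub> w \<Longrightarrow> \<not> u \<rightarrow>\<^bsub>G\<^esub> w"
  obtains P where "partition_on (verts G) P"
    "arcs_ends G = {(u, v). \<exists>A \<in> P. \<exists>B \<in> P. A \<noteq> B \<and> u \<in> A \<and> v \<in> B}"
proof -
  define r where "r = {(u, v) \<in> verts G \<times> verts G. \<not> u \<rightarrow>\<^bsub>G\<^esub> v}"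
  have r: "equiv (verts G) r"
  proof (rule equivI)
    show "r \<subseteq> verts G \<times> verts G" by (auto simp: r_def)
    show "refl_on (verts G) r" by (auto simp: r_def adj_irrefl intro!: refl_onI)
    show "sym r" by (auto simp: r_def intro!: symI dest: adj_sym)
    show "trans r" using assms unfolding r_def trans_def by blast
  qed
  have "(u, v) \<in> arcs_ends G \<longleftrightarrow> (\<exists>A \<in> verts G // r. \<exists>B \<in> verts G // r. A \<noteq> B \<and> u \<in> A \<and> v \<in> B)" for u v
  proof
    assume uv: "(u, v) \<in> arcs_ends G"
    then have V: "u \<in> verts G" "v \<in> verts G" by (auto dest: adj_in_verts)
    have "(u, v) \<notin> r" using uv by (simp add: r_def)
    then have "r `` {u} \<noteq> r `` {v}" using V by (simp add: eq_equiv_class_iff[OF r])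
    moreover have "u \<in> r `` {u}" "v \<in> r `` {v}" using V equiv_class_self[OF r] by auto
    moreover have "r `` {u} \<in> verts G // r" "r `` {v} \<in> verts G // r" using V by (auto intro: quotientI)
    ultimately show "\<exists>A \<in> verts G // r. \<exists>B \<in> verts G // r. A \<noteq> B \<and> u \<in> A \<and> v \<in> B" by metis
  next
    assume "\<exists>A \<in> verts G // r. \<exists>B \<in> verts G // r. A \<noteq> B \<and> u \<in> A \<and> v \<in> B"
    then obtain A B where AB: "A \<in> verts G // r" "B \<in> verts G // r" "A \<noteq> B" "u \<in> A" "v \<in> B" by blast
    then have "u \<in> verts G" "v \<in> verts G" using Union_quotient[OF r] by blast+
    moreover have "(u, v) \<notin> r" using AB(3) quotient_eqI[OF r AB(1,2,4,5)] by auto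
    ultimately show "(u, v) \<in> arcs_ends G" by (auto simp: r_def)
  qed
  then have "arcs_ends G =
      {(u, v). \<exists>A \<in> verts G // r. \<exists>B \<in> verts G // r. A \<noteq> B \<and> u \<in> A \<and> v \<in> B}"
    by (simp add: set_eq_iff[of "arcs_ends G"] split_paired_all)
  with partition_on_quotient[OF r] that show ?thesis by blast
qed

end

section \<open>The Q-index\<close>

text \<open>No vertex is isolated, and an edge is a clique of order 2. This makes all the weights
  \<open>1 - 1 / c v\<close> positive.\<close>

lemma (in graph) two_le_vertex_clique_number:
  assumes conn: "Digraph_Component.connected G" and "2 \<le> card (verts G)" and v: "v \<in> verts G"
  shows "2 \<le> vertex_clique_number G v"
proof -
  have "\<exists>w. v \<rightarrow>\<^bsub>G\<^esub> w"
  proof (rule ccontr)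
    assume "\<nexists>w. v \<rightarrow>\<^bsub>G\<^esub> w"
    then have "w = v" if "w \<in> verts G" for w
      using connected_induct[OF conn v that, of "\<lambda>x. x = v"] by blast
    then have "verts G \<subseteq> {v}" by auto
    then show False using assms(2) card_mono[of "{v}" "verts G"] by simp
  qed
  then obtain w where "v \<rightarrow>\<^bsub>G\<^esub> w" ..
  moreover have "v \<noteq> w" using calculation adj_irrefl by auto
  moreover have "w \<in> verts G" using calculation adj_in_verts by auto
  moreover have "w \<rightarrow>\<^bsub>G\<^esub> v" using calculation adj_sym by auto
  ultimately show ?thesis
    using vertex_clique_number_ge[of "{v, w}" v] v by (auto simp: pairwise_def)
qed

lemma (in graph) clique_weighted:
  assumes "Digraph_Component.connected G" "2 \<le> card (verts G)"
  shows "clique_weighted_graph (verts G) (dominates G) (\<lambda>v. 1 - 1 / real (vertex_clique_number G v))"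
proof unfold_locales
  show "1 - 1 / real (card K) \<le> 1 - 1 / real (vertex_clique_number G v)"
    if "K \<subseteq> verts G" "pairwise (dominates G) K" "v \<in> K" for K v
  proof -
    have "0 < card K" using that finite_subset[OF that(1)] by (auto simp: card_gt_0_iff)
    then show ?thesis using vertex_clique_number_ge[OF that] by (simp add: frac_le)
  qed
  show "0 < 1 - 1 / real (vertex_clique_number G v)" if "v \<in> verts G" for v
    using two_le_vertex_clique_number[OF assms that] by simp
qed (auto intro: adj_sym simp: adj_irrefl)

lemma (in graph) Q_eigenfunction_edge_form:
  assumes "Q_eigenfunction G q x"
  shows "edge_form (verts G) (dominates G) (\<lambda>_. 1) x = 2 * q * (\<Sum>v\<in>verts G. (x v)\<^sup>2)"
  using assms adj_sym by (intro edge_form_eigenfunction) (auto simp: Q_eigenfunction_def)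

text \<open>A Perron-Frobenius argument: at a zero of \<open>x\<close> the eigenvalue equation
  forces all neighbouring values to be zero, and connectedness spreads the zeros over the whole
  graph.\<close>

lemma (in graph) Q_eigenfunction_nonneg_pos:
  assumes conn: "Digraph_Component.connected G" and x: "Q_eigenfunction G q x"
    and nonneg: "\<And>v. 0 \<le> x v" and v: "v \<in> verts G"
  shows "0 < x v"
proof (rule ccontr)
  assume "\<not> 0 < x v"
  then have "x v = 0" using nonneg[of v] by simp
  have "w \<in> verts G \<and> x w = 0" if "w \<in> verts G" for w
  proof (rule connected_induct[OF conn v that, of "\<lambda>w. w \<in> verts G \<and> x w = 0"])
    fix s t assume s: "s \<in> verts G \<and> x s = 0" and st: "s \<rightarrow>\<^bsub>G\<^esub> t"
    have t: "t \<in> verts G" using st adj_in_verts by auto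
    have "(\<Sum>w\<in>verts G. of_bool (s \<rightarrow>\<^bsub>G\<^esub> w) * (x s + x w)) = q * x s"
      using x s unfolding Q_eigenfunction_def by blast
    then have "(\<Sum>w\<in>verts G. of_bool (s \<rightarrow>\<^bsub>G\<^esub> w) * x w) = 0" using s by simp
    then have "of_bool (s \<rightarrow>\<^bsub>G\<^esub> t) * x t = 0"
      using nonneg t by (subst (asm) sum_nonneg_eq_0_iff) auto
    then show "t \<in> verts G \<and> x t = 0" using st t by simp
  qed (use \<open>x v = 0\<close> v in auto)
  then show False using x unfolding Q_eigenfunction_def by blast
qed

lemma (in graph) Q_index_le:
  assumes conn: "Digraph_Component.connected G" and vs: "distinct vs" "set vs = verts G"
  shows "Q_index G vs \<le> 2 * (\<Sum>v\<in>verts G. 1 - 1 / real (vertex_clique_number G v))"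
    (is "_ \<le> 2 * ?T")
proof -
  have ne: "verts G \<noteq> {}"
    using conn by (auto simp: Digraph_Component.connected_def strongly_connected_def)
  obtain x where x: "Q_eigenfunction G (Q_index G vs) x"
    using Q_index_eigenfunction[OF vs ne] by blast
  then obtain u where u: "u \<in> verts G" "x u \<noteq> 0" by (auto simp: Q_eigenfunction_def)
  show ?thesis
  proof (cases "2 \<le> card (verts G)")
    case True
    interpret clique_weighted_graph "verts G" "dominates G" "\<lambda>v. 1 - 1 / real (vertex_clique_number G v)"
      by (rule clique_weighted[OF conn True])
    have "(x u)\<^sup>2 \<le> (\<Sum>v\<in>verts G. (x v)\<^sup>2)" using u by (intro member_le_sum) auto
    moreover have "0 < (x u)\<^sup>2" using u by simp
    ultimately have "0 < (\<Sum>v\<in>verts G. (x v)\<^sup>2)" by linarith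
    moreover have "2 * Q_index G vs * (\<Sum>v\<in>verts G. (x v)\<^sup>2) \<le> 2 * (2 * ?T) * (\<Sum>v\<in>verts G. (x v)\<^sup>2)"
      using edge_form_bound_1[of x] Q_eigenfunction_edge_form[OF x] by simp
    ultimately show ?thesis by simp
  \<comment> \<open>A single vertex has clique order 1 and weight 0, so the locale does not apply;
    its Q-index is 0.\<close>
  next
    case False
    then have "card (verts G) = 1" using ne card_gt_0_iff[of "verts G"] by simp
    then have "verts G = {u}" using u(1) by (auto simp: card_1_singleton_iff)
    then have "Q_index G vs * x u = 0"
      using x unfolding Q_eigenfunction_def by (auto simp: adj_irrefl)
    moreover have "0 \<le> ?T"
      by (intro sum_nonneg) (use vertex_clique_number_pos in \<open>fastforce simp: divide_le_eq_1\<close>)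
    ultimately show ?thesis using u by simp
  qed
qed

lemma (in graph) Q_index_extremal:
  assumes conn: "Digraph_Component.connected G" and vs: "distinct vs" "set vs = verts G"
    and ext: "Q_index G vs = 2 * (\<Sum>v\<in>verts G. 1 - 1 / real (vertex_clique_number G v))"
    and card: "2 \<le> card (verts G)"
  shows "complete_multipartite_graph (clique_number G) G"
    and "3 \<le> clique_number G \<Longrightarrow> regular_graph G"
proof -
  define T where "T = (\<Sum>v\<in>verts G. 1 - 1 / real (vertex_clique_number G v))"
  interpret clique_weighted_graph "verts G" "dominates G" "\<lambda>v. 1 - 1 / real (vertex_clique_number G v)"
    by (rule clique_weighted[OF conn card])
  have ne: "verts G \<noteq> {}" using card by auto
  obtain x0 where x0: "Q_eigenfunction G (2 * T) x0"
    using Q_index_eigenfunction[OF vs ne] ext T_def by metis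
  \<comment> \<open>The absolute value is again extremal, hence an eigenfunction, hence positive by
    connectedness. Positivity rules out \<open>x u + x w = 0\<close> in the transitivity
    argument.\<close>
  define x where "x v = \<bar>x0 v\<bar>" for v
  have ext_x: "edge_form (verts G) (dominates G) (\<lambda>_. 1) x = 4 * T * (\<Sum>v\<in>verts G. (x v)\<^sup>2)"
    unfolding x_def T_def
    by (rule extremal_abs) (use Q_eigenfunction_edge_form[OF x0] in \<open>simp add: T_def\<close>)
  have eig: "(\<Sum>w\<in>verts G. of_bool (v \<rightarrow>\<^bsub>G\<^esub> w) * (x v + x w)) = 2 * T * x v" if "v \<in> verts G" for v
    using extremal_eigenfunction[OF ext_x[unfolded T_def] that] by (simp add: T_def)
  have "Q_eigenfunction G (2 * T) x"
    using x0 eig unfolding Q_eigenfunction_def by (simp add: x_def)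
  then have pos: "0 < x v" if "v \<in> verts G" for v
    by (rule Q_eigenfunction_nonneg_pos[OF conn _ _ that]) (simp add: x_def)
  obtain P where P: "partition_on (verts G) P"
    "arcs_ends G = {(u, v). \<exists>A \<in> P. \<exists>B \<in> P. A \<noteq> B \<and> u \<in> A \<and> v \<in> B}"
  proof (rule nonadjacent_trans_multipartite)
    show "\<not> u \<rightarrow>\<^bsub>G\<^esub> w" if "u \<in> verts G" "v \<in> verts G" "w \<in> verts G" "\<not> u \<rightarrow>\<^bsub>G\<^esub> v" "\<not> v \<rightarrow>\<^bsub>G\<^esub> w" for u v w
    proof (rule extremal_nonadjacent_trans[OF ext_x[unfolded T_def] that])
      show "x u + x w \<noteq> 0" using pos[of u] pos[of w] that by linarith
    qed
  qed
  have omega: "clique_number G = card P" by (rule multipartite_clique_number[OF P ne])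
  have graph: "graph G" by unfold_locales
  show "complete_multipartite_graph (clique_number G) G"
    unfolding complete_multipartite_graph_def omega using graph P by blast
  show "regular_graph G" if 3: "3 \<le> clique_number G"
  proof -
    have const: "x u = x v" if "u \<in> verts G" "v \<in> verts G" for u v
    proof (rule extremal_constant[OF ext_x[unfolded T_def] _ _ _ that])
      show "1 - 1 / real (vertex_clique_number G v) = 1 - 1 / real (card P)" if "v \<in> verts G" for v
        using multipartite_vertex_clique_number[OF P that] by simp
      show "1 / 2 < 1 - 1 / real (card P)" using 3 omega by (simp add: field_simps)
    qed (simp add: x_def)
    \<comment> \<open>For constant \<open>x\<close> the eigenvalue equation reads off the
      degree.\<close>
    have "real (out_degree G v) = T" if v: "v \<in> verts G" for v
    proof -
      have "2 * T * x v = (\<Sum>w\<in>verts G. of_bool (v \<rightarrow>\<^bsub>G\<^esub> w) * (2 * x v))"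
        unfolding eig[OF v, symmetric] using const[OF v] by (intro sum.cong refl) simp
      also have "\<dots> = 2 * real (out_degree G v) * x v"
        unfolding out_degree_eq_sum sum_distrib_right[symmetric] by simp
      finally show ?thesis using pos[OF v] by simp
    qed
    then show ?thesis unfolding regular_graph_def using graph by (metis of_nat_eq_iff)
  qed
qed

section \<open>Lower bounds from explicit eigenfunctions\<close>

lemma (in graph) complete_bipartite_Q_index_ge:
  assumes vs: "distinct vs" "set vs = verts G"
    and "0 < m" "0 < n" and "complete_bipartite_digraph m n G"
  shows "real (card (verts G)) \<le> Q_index G vs"
proof -
  obtain U W where UW: "verts G = U \<union> W" "U \<inter> W = {}" "card U = m" "card W = n"
    and ends: "arcs_ends G = U \<times> W \<union> W \<times> U"
    using assms(5) by (auto simp: complete_bipartite_digraph_def)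
  have fin: "finite U" "finite W" using UW(1) finite_verts by (metis finite_Un)+
  have ne: "U \<noteq> {}" using UW \<open>0 < m\<close> by auto
  \<comment> \<open>Each vertex carries the size of the opposite side, its degree, so adjacent
    values always add up to \<open>m + n\<close>, which becomes the eigenvalue.\<close>
  define x where "x v = (if v \<in> U then real n else real m)" for v
  have "Q_eigenfunction G (real (m + n)) x"
    unfolding Q_eigenfunction_def
  proof (intro conjI ballI)
    show "\<exists>v\<in>verts G. x v \<noteq> 0" using ne UW(1) \<open>0 < n\<close> by (auto simp: x_def)
    fix v assume v: "v \<in> verts G"
    have sum_adj: "(\<Sum>w\<in>verts G. of_bool (v \<rightarrow>\<^bsub>G\<^esub> w) * (x v + x w)) = (\<Sum>w\<in>B. x v + x w)"
      if B: "B \<subseteq> verts G" "\<And>w. v \<rightarrow>\<^bsub>G\<^esub> w \<longleftrightarrow> w \<in> B" for B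
      by (rule sum.mono_neutral_cong_right) (use B in auto)
    show "(\<Sum>w\<in>verts G. of_bool (v \<rightarrow>\<^bsub>G\<^esub> w) * (x v + x w)) = real (m + n) * x v"
    proof (cases "v \<in> U")
      case True
      have "(\<Sum>w\<in>verts G. of_bool (v \<rightarrow>\<^bsub>G\<^esub> w) * (x v + x w)) = (\<Sum>w\<in>W. x v + x w)"
        by (rule sum_adj) (use True UW ends in auto)
      also have "\<dots> = (\<Sum>w\<in>W. real n + real m)"
        by (intro sum.cong refl) (use True UW in \<open>auto simp: x_def\<close>)
      finally show ?thesis using True UW by (simp add: x_def)
    next
      case False
      then have "v \<in> W" using v UW by auto
      have "(\<Sum>w\<in>verts G. of_bool (v \<rightarrow>\<^bsub>G\<^esub> w) * (x v + x w)) = (\<Sum>w\<in>U. x v + x w)"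
        by (rule sum_adj) (use \<open>v \<in> W\<close> False UW ends in auto)
      also have "\<dots> = (\<Sum>w\<in>U. real m + real n)"
        by (intro sum.cong refl) (use False in \<open>auto simp: x_def\<close>)
      finally show ?thesis using False UW by (simp add: x_def)
    qed
  qed
  moreover have "card (verts G) = m + n" using UW fin by (simp add: card_Un_disjoint)
  ultimately show ?thesis using Q_index_ge[OF vs] ne UW(1) by auto
qed

text \<open>Regularity of degree \<open>d\<close> gives all parts the size
  \<open>card (verts G) - d\<close>, so \<open>d\<close> is
  \<open>card (verts G) * (1 - 1 / r)\<close>; the constant function is an eigenfunction for
  \<open>2 * d\<close>.\<close>

lemma (in graph) regular_multipartite_Q_index_ge:
  assumes vs: "distinct vs" "set vs = verts G" and ne: "verts G \<noteq> {}"
    and "regular_graph G" and "complete_multipartite_graph r G"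
  shows "2 * (real (card (verts G)) * (1 - 1 / real r)) \<le> Q_index G vs"
proof -
  obtain P where P: "partition_on (verts G) P"
    "arcs_ends G = {(u, v). \<exists>A \<in> P. \<exists>B \<in> P. A \<noteq> B \<and> u \<in> A \<and> v \<in> B}" and r: "card P = r"
    using assms(5) by (auto simp: complete_multipartite_graph_def)
  obtain d where d: "\<And>v. v \<in> verts G \<Longrightarrow> out_degree G v = d"
    using assms(4) by (auto simp: regular_graph_def)
  have finP: "finite P" by (rule finite_elements[OF finite_verts P(1)])
  have part_card: "card A = card (verts G) - d" if "A \<in> P" for A
  proof -
    have "A \<noteq> {}" using partition_onD3[OF P(1)] that by auto
    then obtain v where "v \<in> A" by auto
    moreover have "v \<in> verts G" using \<open>v \<in> A\<close> that partition_onD1[OF P(1)] by auto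
    ultimately show ?thesis using multipartite_out_degree[OF P that] d by fastforce
  qed
  have "d \<le> card (verts G)"
  proof -
    obtain v where v: "v \<in> verts G" using ne by auto
    then obtain A where A: "A \<in> P" "v \<in> A" using partition_onD1[OF P(1)] by auto
    show ?thesis using multipartite_out_degree[OF P A] d[OF v] by simp
  qed
  have "card (verts G) = (\<Sum>A\<in>P. card A)"
    using card_Union_disjoint[of P] partition_onD1[OF P(1)] partition_onD2[OF P(1)] finite_verts
    by (metis (no_types, lifting) Union_upper disjoint_def finite_subset pairwise_def disjnt_def)
  also have "\<dots> = r * (card (verts G) - d)" using part_card r by simp
  finally have n: "real (card (verts G)) = real r * (real (card (verts G)) - real d)"
    using \<open>d \<le> card (verts G)\<close> by (metis of_nat_diff of_nat_mult)
  have "r > 0" using n ne by (cases r) auto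
  then have "2 * (real (card (verts G)) * (1 - 1 / real r)) = 2 * real d"
    using n by (simp add: field_simps)
  moreover have "Q_eigenfunction G (2 * real d) (\<lambda>_. 1)"
    using ne d out_degree_eq_sum by (auto simp: Q_eigenfunction_def sum_distrib_right[symmetric])
  ultimately show ?thesis using Q_index_ge[OF vs ne] by auto
qed

lemma (in graph) multipartite_2_imp_complete_bipartite:
  assumes "complete_multipartite_graph 2 G"
  shows "\<exists>m n. m > 0 \<and> n > 0 \<and> complete_bipartite_digraph m n G"
proof -
  obtain P where P: "partition_on (verts G) P" "card P = 2"
    "arcs_ends G = {(u, v). \<exists>A \<in> P. \<exists>B \<in> P. A \<noteq> B \<and> u \<in> A \<and> v \<in> B}"
    using assms by (auto simp: complete_multipartite_graph_def)
  obtain U W where UW: "P = {U, W}" "U \<noteq> W" using P(2) by (auto simp: card_2_iff)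
  have V: "verts G = U \<union> W" using partition_onD1[OF P(1)] UW by simp
  have "U \<inter> W = {}" using partition_onD2[OF P(1)] UW by (auto simp: disjoint_def)
  moreover have "arcs_ends G = U \<times> W \<union> W \<times> U" unfolding P(3) UW using UW(2) by auto
  moreover have "graph G" by unfold_locales
  ultimately have "complete_bipartite_digraph (card U) (card W) G"
    using V unfolding complete_bipartite_digraph_def by blast
  moreover have "finite U" "finite W" using V finite_verts by (metis finite_Un)+
  moreover have "U \<noteq> {}" "W \<noteq> {}" using partition_onD3[OF P(1)] UW by auto
  ultimately show ?thesis by (metis card_gt_0_iff)
qed

theorem theorem1p4:
  fixes G :: "('a, 'b) pre_digraph" and vs :: "'a list"
  assumes "graph G" and "Digraph_Component.connected G"
    and "distinct vs" and "set vs = verts G"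
  shows "Q_index G vs \<le> 2 * (\<Sum>v\<in>verts G. 1 - 1 / real (vertex_clique_number G v)) \<and>
    (clique_number G = 2 \<longrightarrow>
      (Q_index G vs = 2 * (\<Sum>v\<in>verts G. 1 - 1 / real (vertex_clique_number G v)) \<longleftrightarrow>
       (\<exists>m n. m > 0 \<and> n > 0 \<and> complete_bipartite_digraph m n G))) \<and>
    (clique_number G \<ge> 3 \<longrightarrow>
      (Q_index G vs = 2 * (\<Sum>v\<in>verts G. 1 - 1 / real (vertex_clique_number G v)) \<longleftrightarrow>
       regular_graph G \<and> complete_multipartite_graph (clique_number G) G))"
proof -
  interpret graph G by fact
  define T where "T = (\<Sum>v\<in>verts G. 1 - 1 / real (vertex_clique_number G v))"
  note vs = assms(3,4)
  have ne: "verts G \<noteq> {}"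
    using assms(2) by (auto simp: Digraph_Component.connected_def strongly_connected_def)
  have le: "Q_index G vs \<le> 2 * T" unfolding T_def by (rule Q_index_le[OF assms(2) vs])
  have T_le: "T \<le> real (card (verts G)) * (1 - 1 / real (clique_number G))"
    unfolding T_def by (rule sum_clique_weight_le)
  have "clique_number G \<le> card (verts G)"
    by (metis card_mono clique_numberE finite_verts)
  then have card: "2 \<le> card (verts G)" if "2 \<le> clique_number G" using that by simp
  note ext = Q_index_extremal[OF assms(2) vs, folded T_def]
  have "Q_index G vs = 2 * T \<longleftrightarrow> (\<exists>m n. m > 0 \<and> n > 0 \<and> complete_bipartite_digraph m n G)"
    if "clique_number G = 2"
  proof
    assume "Q_index G vs = 2 * T"
    then have "complete_multipartite_graph 2 G" using ext(1) card that by simp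
    then show "\<exists>m n. m > 0 \<and> n > 0 \<and> complete_bipartite_digraph m n G"
      by (rule multipartite_2_imp_complete_bipartite)
  next
    assume "\<exists>m n. m > 0 \<and> n > 0 \<and> complete_bipartite_digraph m n G"
    then have "real (card (verts G)) \<le> Q_index G vs" using complete_bipartite_Q_index_ge[OF vs] by blast
    \<comment> \<open>The chain \<open>card (verts G) <= Q_index G vs <= 2 * T <= 2 * card (verts G)
      * (1 - 1 / 2)\<close> closes up.\<close>
    then show "Q_index G vs = 2 * T" using le T_le that by simp
  qed
  moreover have "Q_index G vs = 2 * T \<longleftrightarrow>
      regular_graph G \<and> complete_multipartite_graph (clique_number G) G"
    if "3 \<le> clique_number G"
  proof
    assume "Q_index G vs = 2 * T"
    then show "regular_graph G \<and> complete_multipartite_graph (clique_number G) G"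
      using ext card that by simp
  next
    assume "regular_graph G \<and> complete_multipartite_graph (clique_number G) G"
    then show "Q_index G vs = 2 * T"
      using regular_multipartite_Q_index_ge[OF vs ne] le T_le by fastforce
  qed
  ultimately show ?thesis using le unfolding T_def by blast
qed

end
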